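(* Let $(W,S)$ be a Coxeter system with $S$ finite. Let $\mathscr{P}$ be a locally constant, convex, gated partition of $W$, and for each $P\in\mathscr{P}$ let $g_P$ denote the gate of $P$. Suppose that $\mathscr{P}'$ is the simple refinement of $\mathscr{P}$ based at $(P,s)$. Let $X=\{P'\in\mathscr{P}\mid sP\cap P'\neq\emptyset\}$, and let $P_0'$ be the element of $X$ with $sg_P\in P_0'$. Then: (1) the partition $\mathscr{P}'$ is locally constant, convex, and gated; (2) the element $g_P$ is the gate of $P\cap sP_0'$, and for each $P'\in X\setminus\{P_0'\}$ the set $\{g_P,sg_{P'}\}$ is bounded and $h_{P'}=g_P\vee sg_{P'}$ is the gate of $P\cap sP'$; (3) if $\mathscr{P}$ has the property that each of its parts is an intersection of finitely many half-spaces, then the partition $\mathscr{P}'$ also has this property.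
   Context: $\ell$ is the length function, $D_L(w)=\{s\in S\mid\ell(sw)=\ell(w)-1\}$, and $x\preccurlyeq y$ means $\ell(x^{-1}y)=\ell(y)-\ell(x)$ (right weak order). A subset of $W$ is bounded if it has an upper bound in $(W,\preccurlyeq)$; every bounded subset has a least upper bound, and $x\vee y$ denotes the least upper bound of $\{x,y\}$. A partition of $W$ is a set of nonempty pairwise disjoint subsets (parts) with union $W$. It is locally constant if $D_L$ is constant on each part $P$ (common value $D_L(P)$). A subset $Y\subseteq W$ is convex if for all $x,y\in Y$ and all reduced expressions $x^{-1}y=s_1\cdots s_n$, each $xs_1\cdots s_j$ ($0\le j\le n$) is in $Y$. A subset $Y\subseteq W$ is gated if there is $g\in Y$ (its gate, necessarily unique) with $g\preccurlyeq y$ for all $y\in Y$. A partition is convex (respectively gated) if all of its parts are. Simple refinement: let $\mathscr{P}$ be locally constant, and let $(P,s)\in\mathscr{P}\times S$ with $s\notin D_L(P)$ and $sP$ not contained in any part of $\mathscr{P}$. With $X=\{P'\in\mathscr{P}\mid P'\cap sP\neq\emptyset\}$, the simple refinement of $\mathscr{P}$ based at $(P,s)$ is the partition obtained by replacing the part $P$ by the parts $P\cap sP'$, $P'\in X$. Half-spaces are the subsets $\{w\in W\mid\ell(rw)>\ell(w)\}$ and $\{w\in W\mid\ell(rw)<\ell(w)\}$, for $r$ a reflection, i.e. an element of the form $vsv^{-1}$ with $v\in W$, $s\in S$. *)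

theory Defs
  imports "HOL-Algebra.Coset" "HOL-Algebra.Lattice" "HOL-Algebra.Generated_Groups"
    "HOL-Library.Disjoint_Sets"
begin

definition word_prod :: "('a, 'b) monoid_scheme \<Rightarrow> 'a list \<Rightarrow> 'a" where
  "word_prod W ws = foldr (\<otimes>\<^bsub>W\<^esub>) ws \<one>\<^bsub>W\<^esub>"

text \<open>A Coxeter matrix, with the entry \<open>0\<close> encoding \<open>\<infinity>\<close>.\<close>

definition coxeter_matrix :: "'a set \<Rightarrow> ('a \<Rightarrow> 'a \<Rightarrow> nat) \<Rightarrow> bool" where
  "coxeter_matrix S m \<longleftrightarrow>
     (\<forall>s\<in>S. \<forall>t\<in>S. m s t = m t s \<and> (m s t = 1 \<longleftrightarrow> s = t))"

text \<open>
  The congruence on words over \<open>S\<close> generated by the Coxeter relations \<open>(s t)\<^sup>m = 1\<close> with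
  \<open>m = m s t\<close>. These include \<open>s s = 1\<close>, so formal inverses of the letters are not needed and the
  quotient of the words by this congruence is the group presented by these relations. For
  \<open>m s t = 0\<close>, that is \<open>\<infinity>\<close>, the relator is the empty word and imposes nothing.
\<close>

inductive coxeter_cong :: "'a set \<Rightarrow> ('a \<Rightarrow> 'a \<Rightarrow> nat) \<Rightarrow> 'a list \<Rightarrow> 'a list \<Rightarrow> bool"
  for S :: "'a set" and m :: "'a \<Rightarrow> 'a \<Rightarrow> nat" where
  relator: "\<lbrakk>s \<in> S; t \<in> S; us \<in> lists S; vs \<in> lists S\<rbrakk>
    \<Longrightarrow> coxeter_cong S m (us @ concat (replicate (m s t) [s, t]) @ vs) (us @ vs)"
| refl: "us \<in> lists S \<Longrightarrow> coxeter_cong S m us us"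
| sym: "coxeter_cong S m us vs \<Longrightarrow> coxeter_cong S m vs us"
| trans: "\<lbrakk>coxeter_cong S m us vs; coxeter_cong S m vs ws\<rbrakk> \<Longrightarrow> coxeter_cong S m us ws"

locale coxeter_system = group W
  for W :: "('a, 'b) monoid_scheme" (structure) and S :: "'a set" +
  assumes gens_closed: "S \<subseteq> carrier W"
    and generates: "generate W S = carrier W"
    and presentation: "\<exists>m. coxeter_matrix S m \<and>
      (\<forall>us\<in>lists S. \<forall>vs\<in>lists S.
         word_prod W us = word_prod W vs \<longleftrightarrow> coxeter_cong S m us vs)"

definition len :: "('a, 'b) monoid_scheme \<Rightarrow> 'a set \<Rightarrow> 'a \<Rightarrow> nat" where
  "len W S w = (LEAST n. \<exists>ws\<in>lists S. length ws = n \<and> word_prod W ws = w)"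

definition reduced_expression :: "('a, 'b) monoid_scheme \<Rightarrow> 'a set \<Rightarrow> 'a list \<Rightarrow> 'a \<Rightarrow> bool" where
  "reduced_expression W S ws w \<longleftrightarrow>
     ws \<in> lists S \<and> word_prod W ws = w \<and> length ws = len W S w"

definition left_descents :: "('a, 'b) monoid_scheme \<Rightarrow> 'a set \<Rightarrow> 'a \<Rightarrow> 'a set" where
  "left_descents W S w = {s \<in> S. int (len W S (s \<otimes>\<^bsub>W\<^esub> w)) = int (len W S w) - 1}"

definition weak_order :: "('a, 'b) monoid_scheme \<Rightarrow> 'a set \<Rightarrow> 'a gorder" where
  "weak_order W S = \<lparr>carrier = carrier W, eq = (=),
     le = (\<lambda>x y. int (len W S (inv\<^bsub>W\<^esub> x \<otimes>\<^bsub>W\<^esub> y)) = int (len W S y) - int (len W S x))\<rparr>"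

definition bounded_subset :: "('a, 'b) monoid_scheme \<Rightarrow> 'a set \<Rightarrow> 'a set \<Rightarrow> bool" where
  "bounded_subset W S Y \<longleftrightarrow> Y \<subseteq> carrier W \<and> Upper (weak_order W S) Y \<noteq> {}"

definition is_gate :: "('a, 'b) monoid_scheme \<Rightarrow> 'a set \<Rightarrow> 'a \<Rightarrow> 'a set \<Rightarrow> bool" where
  "is_gate W S g Y \<longleftrightarrow> least (weak_order W S) g Y"

definition gated :: "('a, 'b) monoid_scheme \<Rightarrow> 'a set \<Rightarrow> 'a set \<Rightarrow> bool" where
  "gated W S Y \<longleftrightarrow> (\<exists>g. is_gate W S g Y)"

definition convex_subset :: "('a, 'b) monoid_scheme \<Rightarrow> 'a set \<Rightarrow> 'a set \<Rightarrow> bool" where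
  "convex_subset W S Y \<longleftrightarrow> Y \<subseteq> carrier W \<and>
     (\<forall>x\<in>Y. \<forall>y\<in>Y. \<forall>ws. reduced_expression W S ws (inv\<^bsub>W\<^esub> x \<otimes>\<^bsub>W\<^esub> y) \<longrightarrow>
        (\<forall>j\<le>length ws. x \<otimes>\<^bsub>W\<^esub> word_prod W (take j ws) \<in> Y))"

definition locally_constant_partition ::
  "('a, 'b) monoid_scheme \<Rightarrow> 'a set \<Rightarrow> 'a set set \<Rightarrow> bool" where
  "locally_constant_partition W S \<P> \<longleftrightarrow> partition_on (carrier W) \<P> \<and>
     (\<forall>P\<in>\<P>. \<forall>x\<in>P. \<forall>y\<in>P. left_descents W S x = left_descents W S y)"

definition convex_partition :: "('a, 'b) monoid_scheme \<Rightarrow> 'a set \<Rightarrow> 'a set set \<Rightarrow> bool" where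
  "convex_partition W S \<P> \<longleftrightarrow>
     partition_on (carrier W) \<P> \<and> (\<forall>P\<in>\<P>. convex_subset W S P)"

definition gated_partition :: "('a, 'b) monoid_scheme \<Rightarrow> 'a set \<Rightarrow> 'a set set \<Rightarrow> bool" where
  "gated_partition W S \<P> \<longleftrightarrow>
     partition_on (carrier W) \<P> \<and> (\<forall>P\<in>\<P>. gated W S P)"

text \<open>The common value of \<open>left_descents\<close> on a part of a locally constant partition.\<close>

definition part_descents :: "('a, 'b) monoid_scheme \<Rightarrow> 'a set \<Rightarrow> 'a set \<Rightarrow> 'a set" where
  "part_descents W S P = the_elem (left_descents W S ` P)"

definition is_simple_refinement ::
  "('a, 'b) monoid_scheme \<Rightarrow> 'a set \<Rightarrow> 'a set set \<Rightarrow> 'a set \<Rightarrow> 'a \<Rightarrow> 'a set set \<Rightarrow> bool" where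
  "is_simple_refinement W S \<P> P s \<P>' \<longleftrightarrow>
     locally_constant_partition W S \<P> \<and> P \<in> \<P> \<and> s \<in> S \<and>
     s \<notin> part_descents W S P \<and> \<not> (\<exists>Q\<in>\<P>. s <#\<^bsub>W\<^esub> P \<subseteq> Q) \<and>
     \<P>' = (\<P> - {P}) \<union> {P \<inter> (s <#\<^bsub>W\<^esub> P') | P'. P' \<in> \<P> \<and> P' \<inter> (s <#\<^bsub>W\<^esub> P) \<noteq> {}}"

definition reflections :: "('a, 'b) monoid_scheme \<Rightarrow> 'a set \<Rightarrow> 'a set" where
  "reflections W S = {v \<otimes>\<^bsub>W\<^esub> s \<otimes>\<^bsub>W\<^esub> inv\<^bsub>W\<^esub> v | v s. v \<in> carrier W \<and> s \<in> S}"

definition half_spaces :: "('a, 'b) monoid_scheme \<Rightarrow> 'a set \<Rightarrow> 'a set set" where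
  "half_spaces W S =
     (\<Union>r\<in>reflections W S. {{w \<in> carrier W. len W S (r \<otimes>\<^bsub>W\<^esub> w) > len W S w},
                            {w \<in> carrier W. len W S (r \<otimes>\<^bsub>W\<^esub> w) < len W S w}})"

text \<open>The intersection of the empty family of half-spaces is the whole group.\<close>

definition finite_half_space_intersection ::
  "('a, 'b) monoid_scheme \<Rightarrow> 'a set \<Rightarrow> 'a set \<Rightarrow> bool" where
  "finite_half_space_intersection W S Y \<longleftrightarrow>
     (\<exists>\<H>. finite \<H> \<and> \<H> \<subseteq> half_spaces W S \<and> Y = carrier W \<inter> \<Inter>\<H>)"

end

theory Submission
  imports Defs
begin

text \<open>
  Since \<open>s \<notin> D\<^sub>L(P)\<close>, the generator \<open>s\<close> is a left descent of every element of a part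
  \<open>P' \<in> X\<close>, and left multiplication by \<open>s\<close> preserves the weak order between elements that all
  have \<open>s\<close> as a left descent. Hence \<open>sP'\<close> is convex with gate \<open>s g\<^bsub>P'\<^esub>\<close>. Any element
  of \<open>P \<inter> sP'\<close> bounds \<open>{g\<^sub>P, s g\<^bsub>P'\<^esub>}\<close>, and by convexity the join of these two gates lies in
  \<open>P \<inter> sP'\<close>, where it is the least element.

  The existence of joins of bounded pairs rests on the exchange property, which is obtained from
  the presentation by counting modulo 2 how often a reflection occurs in the inversion sequence
  of a word.
\<close>

section \<open>The parity of inversions and the exchange property\<close>

lemma word_prod_Nil [simp]: "word_prod G [] = \<one>\<^bsub>G\<^esub>"
  and word_prod_Cons [simp]: "word_prod G (x # xs) = x \<otimes>\<^bsub>G\<^esub> word_prod G xs"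
  by (simp_all add: word_prod_def)

lemma (in monoid) word_prod_closed [simp, intro]:
  "ws \<in> lists (carrier G) \<Longrightarrow> word_prod G ws \<in> carrier G"
  by (induction ws) auto

lemma (in monoid) word_prod_append:
  "us \<in> lists (carrier G) \<Longrightarrow> vs \<in> lists (carrier G) \<Longrightarrow>
    word_prod G (us @ vs) = word_prod G us \<otimes> word_prod G vs"
  by (induction us) (auto simp: m_assoc)

lemma (in monoid) word_prod_replicate_pair:
  "s \<in> carrier G \<Longrightarrow> t \<in> carrier G \<Longrightarrow>
    word_prod G (concat (replicate n [s, t])) = (s \<otimes> t) [^] n"
proof (induction n)
  case (Suc n)
  have "(s \<otimes> t) [^] Suc n = s \<otimes> t \<otimes> (s \<otimes> t) [^] n"
    using Suc.prems by (simp only: nat_pow_Suc2 m_closed)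
  then show ?case using Suc by (simp add: m_assoc)
qed simp

context group
begin

lemma inv_cancel [simp]: "x \<in> carrier G \<Longrightarrow> y \<in> carrier G \<Longrightarrow> inv x \<otimes> (x \<otimes> y) = y"
  and cancel_inv [simp]: "x \<in> carrier G \<Longrightarrow> y \<in> carrier G \<Longrightarrow> x \<otimes> (inv x \<otimes> y) = y"
  by (simp_all flip: m_assoc)

text \<open>
  Whether \<open>t\<close> occurs an odd number of times in the sequence of the elements
  \<open>(s\<^sub>1 \<cdots> s\<^bsub>i-1\<^esub>) s\<^sub>i (s\<^sub>1 \<cdots> s\<^bsub>i-1\<^esub>)\<inverse>\<close>
  attached to a word \<open>s\<^sub>1 \<cdots> s\<^sub>n\<close>.
\<close>

fun odd_inv :: "'a list \<Rightarrow> 'a \<Rightarrow> bool" where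
  "odd_inv [] t \<longleftrightarrow> False"
| "odd_inv (s # ws) t \<longleftrightarrow> (t = s) \<noteq> odd_inv ws (inv s \<otimes> t \<otimes> s)"

lemma odd_inv_append:
  assumes "us \<in> lists (carrier G)" "vs \<in> lists (carrier G)" "t \<in> carrier G"
  shows "odd_inv (us @ vs) t \<longleftrightarrow>
    odd_inv us t \<noteq> odd_inv vs (inv (word_prod G us) \<otimes> t \<otimes> word_prod G us)"
  using assms by (induction us arbitrary: t) (auto simp: m_assoc inv_mult_group)

lemma odd_inv_delete:
  assumes "ws \<in> lists (carrier G)" "t \<in> carrier G" "odd_inv ws t"
    "\<And>s. s \<in> set ws \<Longrightarrow> s \<otimes> s = \<one>"
  shows "\<exists>us s vs. ws = us @ s # vs \<and> t \<otimes> word_prod G ws = word_prod G (us @ vs)"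
  using assms
proof (induction ws arbitrary: t rule: list.induct)
  case (Cons s ws)
  have s: "s \<in> carrier G" "s \<otimes> s = \<one>" and ws: "ws \<in> lists (carrier G)"
    using Cons.prems(1,4) by simp_all
  show ?case
  proof (cases "t = s")
    case True
    have "t \<otimes> word_prod G (s # ws) = word_prod G ([] @ ws)"
      using s ws True by (simp flip: m_assoc)
    then show ?thesis by blast
  next
    case False
    then have "odd_inv ws (inv s \<otimes> t \<otimes> s)"
      using Cons.prems by simp
    then obtain us x vs where *: "ws = us @ x # vs"
      "inv s \<otimes> t \<otimes> s \<otimes> word_prod G ws = word_prod G (us @ vs)"
      using Cons s by (metis (no_types, lifting) inv_closed list.set_intros(2) m_closed ws)
    have "t \<otimes> word_prod G (s # ws) = s \<otimes> (inv s \<otimes> t \<otimes> s \<otimes> word_prod G ws)"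
      using s ws Cons.prems(2) by (simp add: m_assoc)
    then have "t \<otimes> word_prod G (s # ws) = word_prod G ((s # us) @ vs)"
      using * by simp
    then show ?thesis using *(1) by (metis append_Cons)
  qed
qed simp

end

lemma odd_ite_add: "odd ((if P then 1 else 0) + n) \<longleftrightarrow> P \<noteq> odd (n::nat)"
  by simp

context coxeter_system
begin

abbreviation ell :: "'a \<Rightarrow> nat" where "ell \<equiv> len W S"
abbreviation wp :: "'a list \<Rightarrow> 'a" where "wp \<equiv> word_prod W"

lemma S_carrier [simp]: "s \<in> S \<Longrightarrow> s \<in> carrier W"
  using gens_closed by blast

lemma lists_S_carrier [simp]: "ws \<in> lists S \<Longrightarrow> ws \<in> lists (carrier W)"
  using gens_closed by blast

lemma S_square [simp]: "s \<in> S \<Longrightarrow> s \<otimes> s = \<one>"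
proof -
  assume s: "s \<in> S"
  obtain m where m: "coxeter_matrix S m" "\<And>us vs. us \<in> lists S \<Longrightarrow> vs \<in> lists S \<Longrightarrow>
      wp us = wp vs \<longleftrightarrow> coxeter_cong S m us vs"
    using presentation by blast
  \<comment> \<open>A diagonal entry 1 makes the word \<open>[s, s]\<close> itself a
    relator.\<close>
  have "m s s = 1" using m(1) s by (auto simp: coxeter_matrix_def)
  then have "coxeter_cong S m [s, s] []"
    using coxeter_cong.relator[of s S s "[]" "[]" m] s by simp
  then have "wp [s, s] = wp []" using m(2)[of "[s, s]" "[]"] s by simp
  then show ?thesis using s by simp
qed

lemma S_inv [simp]: "s \<in> S \<Longrightarrow> inv s = s"
  by (simp add: inv_equality)

lemma S_cancel [simp]: "s \<in> S \<Longrightarrow> x \<in> carrier W \<Longrightarrow> s \<otimes> (s \<otimes> x) = x"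
  by (simp flip: m_assoc)

text \<open>The elements attached to the \<open>2 * m\<close> letters form a sequence that is
  periodic with period \<open>m\<close>, because \<open>(s \<otimes> t) [^] m = \<one>\<close>.
  Hence every element is hit equally often in the two halves, so an even number of times.\<close>

lemma odd_inv_relator:
  assumes s: "s \<in> S" and t: "t \<in> S" and r: "r \<in> carrier W" and one: "(s \<otimes> t) [^] (m::nat) = \<one>"
  shows "\<not> odd_inv (concat (replicate m [s, t])) r"
proof -
  \<comment> \<open>\<open>f j\<close> is the element attached to the letter in position
    \<open>j\<close> of the alternating word, counted from 0, and \<open>c n r\<close> counts the
    occurrences of \<open>r\<close> among the first \<open>n\<close> of them.\<close>
  define f where "f j = (s \<otimes> t) [^] j \<otimes> s" for j :: nat
  define c where "c n r = (\<Sum>j<n. if f j = r then 1 else 0 :: nat)" for n r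
  have f: "f j \<in> carrier W" for j using s t by (simp add: f_def)
  have f_Suc2: "f (Suc (Suc j)) = s \<otimes> (t \<otimes> (f j \<otimes> (t \<otimes> s)))" for j
  proof -
    have "f (Suc (Suc j)) = (s \<otimes> t) [^] (Suc j + 1) \<otimes> s" by (simp add: f_def)
    also have "\<dots> = (s \<otimes> t) [^] Suc j \<otimes> (s \<otimes> t) \<otimes> s"
      using s t by (simp add: m_assoc)
    also have "(s \<otimes> t) [^] Suc j = (s \<otimes> t) \<otimes> (s \<otimes> t) [^] j"
      using s t by (metis S_carrier m_closed nat_pow_Suc2)
    finally show ?thesis using s t by (simp add: f_def m_assoc)
  qed
  \<comment> \<open>Removing the leading pair \<open>[s, t]\<close> conjugates by
    \<open>s \<otimes> t\<close>, which moves the index by two. This is the recursion of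
    \<open>odd_inv\<close> along the word.\<close>
  have shift: "f (Suc (Suc j)) = r \<longleftrightarrow> f j = t \<otimes> (s \<otimes> (r \<otimes> (s \<otimes> t)))" if "r \<in> carrier W" for j r
  proof
    assume "f (Suc (Suc j)) = r"
    then show "f j = t \<otimes> (s \<otimes> (r \<otimes> (s \<otimes> t)))"
      using s t f[of j] f_Suc2[of j] by (auto simp: m_assoc)
  next
    assume "f j = t \<otimes> (s \<otimes> (r \<otimes> (s \<otimes> t)))"
    then show "f (Suc (Suc j)) = r"
      using s t f[of j] f_Suc2[of j] that by (auto simp: m_assoc)
  qed
  have "odd_inv (concat (replicate n [s, t])) r \<longleftrightarrow> odd (c (2 * n) r)"
    if "r \<in> carrier W" for n r
    using that
  proof (induction n arbitrary: r)
    case 0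
    then show ?case by (simp add: c_def)
  next
    case (Suc n)
    have sts: "s \<otimes> (r \<otimes> s) = t \<longleftrightarrow> f (Suc 0) = r"
    proof
      assume "s \<otimes> (r \<otimes> s) = t"
      then show "f (Suc 0) = r" using s t Suc.prems by (auto simp: f_def m_assoc)
    next
      assume "f (Suc 0) = r"
      then have "r = s \<otimes> (t \<otimes> s)" using s t by (auto simp: f_def m_assoc)
      then show "s \<otimes> (r \<otimes> s) = t" using s t by (simp add: m_assoc)
    qed
    let ?r = "t \<otimes> (s \<otimes> (r \<otimes> (s \<otimes> t)))"
    have "c (2 * Suc n) r = (if f 0 = r then 1 else 0) + ((if f (Suc 0) = r then 1 else 0) + c (2 * n) ?r)"
      using shift[OF Suc.prems] by (simp add: c_def sum.lessThan_Suc_shift del: sum.lessThan_Suc)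
    then have "odd (c (2 * Suc n) r) \<longleftrightarrow> (f 0 = r) \<noteq> ((f (Suc 0) = r) \<noteq> odd (c (2 * n) ?r))"
      by (simp only: odd_ite_add)
    moreover have "f 0 = s" using s by (simp add: f_def)
    moreover have "odd (c (2 * n) ?r) \<longleftrightarrow> odd_inv (concat (replicate n [s, t])) ?r"
      using Suc.IH[of ?r] Suc.prems s t by simp
    ultimately show ?case
      using s t Suc.prems sts by (auto simp: m_assoc)
  qed
  moreover have "even (c (2 * m) r)"
  proof -
    have "f (m + j) = f j" for j
      using s t one by (simp add: f_def flip: nat_pow_mult)
    then have "(\<Sum>j<m. if f (m + j) = r then 1 else 0 :: nat) = c m r" by (simp add: c_def)
    moreover have "sum h {..<m + n} = sum h {..<m} + (\<Sum>j<n. h (m + j))"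
      for h :: "nat \<Rightarrow> nat" and n
      by (induction n) auto
    ultimately have "c (m + m) r = c m r + c m r" by (simp add: c_def)
    then show ?thesis by (simp add: mult_2)
  qed
  ultimately show ?thesis using r by simp
qed

text \<open>A relator contributes an even count, and its product is \<open>\<one>\<close>, so the
  element tested against the letters after it does not change. Inserting or deleting a relator
  therefore preserves every parity.\<close>

lemma odd_inv_cong:
  assumes us: "us \<in> lists S" and vs: "vs \<in> lists S" and eq: "wp us = wp vs" and r: "r \<in> carrier W"
  shows "odd_inv us r \<longleftrightarrow> odd_inv vs r"
proof -
  obtain m where m: "\<And>us vs. us \<in> lists S \<Longrightarrow> vs \<in> lists S \<Longrightarrow>
      wp us = wp vs \<longleftrightarrow> coxeter_cong S m us vs"
    using presentation by blast
  have "coxeter_cong S m us vs" using m us vs eq by blast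
  then show ?thesis
    using r
  proof (induction arbitrary: r)
    case (relator s t us vs)
    let ?w = "concat (replicate (m s t) [s, t])"
    have w: "?w \<in> lists S" using relator by (induction "m s t") auto
    \<comment> \<open>The congruence is read back as an equality of products, from which
      cancellation yields the power relation required by \<open>odd_inv_relator\<close>.\<close>
    have "wp (us @ ?w @ vs) = wp (us @ vs)"
      using m coxeter_cong.relator[OF relator(1-4)] w relator(3,4)
      by (metis append_in_lists_conv)
    then have one: "(s \<otimes> t) [^] m s t = \<one>"
      using w relator
      by (simp add: word_prod_append word_prod_replicate_pair flip: m_assoc)
    let ?r = "inv (wp us) \<otimes> r \<otimes> wp us"
    have "?r \<in> carrier W" using relator by simp
    moreover from this have "\<not> odd_inv ?w ?r"
      using odd_inv_relator[OF relator(1,2) _ one] by blast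
    moreover have "wp ?w = \<one>"
      using relator one by (simp add: word_prod_replicate_pair)
    ultimately show ?case
      using relator w by (simp add: odd_inv_append)
  qed auto
qed

section \<open>Words, length, and the parity as a function on the group\<close>

lemma generate_S_words:
  assumes "w \<in> carrier W"
  obtains ws where "ws \<in> lists S" "wp ws = w"
proof -
  have "w \<in> generate W S" using assms generates by simp
  then have "\<exists>ws\<in>lists S. wp ws = w"
  proof induction
    case one
    show ?case by (rule bexI[of _ "[]"]) auto
  next
    case (incl s)
    then show ?case by (intro bexI[of _ "[s]"]) auto
  next
    case (inv s)
    then show ?case by (intro bexI[of _ "[s]"]) auto
  next
    case (eng x y)
    then obtain us vs where "us \<in> lists S" "wp us = x" "vs \<in> lists S" "wp vs = y" by blast
    then show ?case by (intro bexI[of _ "us @ vs"]) (auto simp: word_prod_append)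
  qed
  then show ?thesis using that by blast
qed

lemma ell_le: "ws \<in> lists S \<Longrightarrow> ell (wp ws) \<le> length ws"
  unfolding len_def by (rule Least_le) blast

lemma reduced_exists:
  assumes "w \<in> carrier W"
  obtains ws where "ws \<in> lists S" "wp ws = w" "length ws = ell w"
proof -
  obtain vs where "vs \<in> lists S" "wp vs = w" using generate_S_words assms by blast
  then have "\<exists>n. \<exists>ws\<in>lists S. length ws = n \<and> wp ws = w" by blast
  from LeastI_ex[OF this] show ?thesis using that unfolding len_def by blast
qed

lemma ell_mult_le:
  assumes "x \<in> carrier W" "y \<in> carrier W"
  shows "ell (x \<otimes> y) \<le> ell x + ell y"
proof -
  obtain us vs where "us \<in> lists S" "wp us = x" "length us = ell x"
    "vs \<in> lists S" "wp vs = y" "length vs = ell y"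
    using assms reduced_exists by metis
  then show ?thesis using ell_le[of "us @ vs"] by (simp add: word_prod_append)
qed

lemma ell_one [simp]: "ell \<one> = 0"
  using ell_le[of "[]"] by simp

lemma ell_eq_0: "x \<in> carrier W \<Longrightarrow> ell x = 0 \<Longrightarrow> x = \<one>"
  by (metis length_0_conv reduced_exists word_prod_Nil)

lemma ell_S_le: "s \<in> S \<Longrightarrow> ell s \<le> 1"
  using ell_le[of "[s]"] by simp

text \<open>By \<open>odd_inv_cong\<close> the choice of the word is immaterial. For a reflection
  \<open>t\<close> this says that \<open>t\<close> is a left inversion of \<open>w\<close>, see
  \<open>odd_at_iff_less\<close>.\<close>

definition odd_at :: "'a \<Rightarrow> 'a \<Rightarrow> bool" where
  "odd_at w t \<longleftrightarrow> (\<exists>ws\<in>lists S. wp ws = w \<and> odd_inv ws t)"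

lemma odd_at_wp: "ws \<in> lists S \<Longrightarrow> t \<in> carrier W \<Longrightarrow> odd_at (wp ws) t \<longleftrightarrow> odd_inv ws t"
  unfolding odd_at_def using odd_inv_cong by blast

lemma odd_at_mult:
  assumes "x \<in> carrier W" "y \<in> carrier W" "t \<in> carrier W"
  shows "odd_at (x \<otimes> y) t \<longleftrightarrow> odd_at x t \<noteq> odd_at y (inv x \<otimes> t \<otimes> x)"
proof -
  obtain us vs where "us \<in> lists S" "wp us = x" "vs \<in> lists S" "wp vs = y"
    using assms generate_S_words by metis
  then show ?thesis
    using assms odd_inv_append[of us vs t] odd_at_wp[of "us @ vs" t] odd_at_wp[of us t]
      odd_at_wp[of vs "inv x \<otimes> t \<otimes> x"]
    by (simp add: word_prod_append)
qed

lemma odd_at_one: "t \<in> carrier W \<Longrightarrow> \<not> odd_at \<one> t"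
  using odd_at_wp[of "[]" t] by simp

lemma odd_at_S: "s \<in> S \<Longrightarrow> t \<in> carrier W \<Longrightarrow> odd_at s t \<longleftrightarrow> t = s"
  using odd_at_wp[of "[s]" t] by simp

lemma reflections_carrier: "t \<in> reflections W S \<Longrightarrow> t \<in> carrier W"
  by (auto simp: reflections_def)

lemma S_reflections: "s \<in> S \<Longrightarrow> s \<in> reflections W S"
  unfolding reflections_def by (force intro: exI[of _ "\<one>"])

lemma reflection_square:
  assumes "t \<in> reflections W S"
  shows "t \<otimes> t = \<one>"
proof -
  obtain v s where v: "v \<in> carrier W" "s \<in> S" "t = v \<otimes> s \<otimes> inv v"
    using assms by (auto simp: reflections_def)
  then show ?thesis by (simp add: m_assoc)
qed

lemma reflection_conj:
  assumes "t \<in> reflections W S" "x \<in> carrier W"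
  shows "x \<otimes> t \<otimes> inv x \<in> reflections W S"
proof -
  obtain v s where v: "v \<in> carrier W" "s \<in> S" "t = v \<otimes> s \<otimes> inv v"
    using assms by (auto simp: reflections_def)
  then have "x \<otimes> t \<otimes> inv x = (x \<otimes> v) \<otimes> s \<otimes> inv (x \<otimes> v)"
    using assms by (simp add: m_assoc inv_mult_group)
  then show ?thesis using v assms unfolding reflections_def by blast
qed

text \<open>Writing \<open>t = v s (inv v)\<close>, the cocycle rule \<open>odd_at_mult\<close>
  splits the parity into contributions of \<open>v\<close>, \<open>s\<close> and
  \<open>inv v\<close>. The outer two cancel since \<open>v \<otimes> inv v = \<one>\<close>, and
  \<open>s\<close> contributes exactly one.\<close>

lemma odd_at_self:
  assumes "t \<in> reflections W S"
  shows "odd_at t t"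
proof -
  obtain v s where v: "v \<in> carrier W" "s \<in> S" "t = v \<otimes> s \<otimes> inv v"
    using assms by (auto simp: reflections_def)
  have t: "t \<in> carrier W" using assms by (rule reflections_carrier)
  have c1: "inv v \<otimes> t \<otimes> v = s"
    using v t by (simp add: m_assoc inv_solve_left')
  have c2: "inv s \<otimes> s \<otimes> s = s" using v by simp
  have "odd_at t t = (odd_at (v \<otimes> (s \<otimes> inv v)) t)" using v by (simp add: m_assoc)
  also have "\<dots> \<longleftrightarrow> odd_at v t \<noteq> odd_at (s \<otimes> inv v) s"
    using odd_at_mult[of v "s \<otimes> inv v" t] v t c1 by simp
  also have "odd_at (s \<otimes> inv v) s \<longleftrightarrow> \<not> odd_at (inv v) s"
    using odd_at_mult[of s "inv v" s] odd_at_S[of s s] v c2 by simp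
  also have "odd_at (inv v) s \<longleftrightarrow> odd_at v t"
    using odd_at_mult[of v "inv v" t] odd_at_one[of t] v t c1 by simp
  finally show ?thesis by simp
qed

lemma odd_at_delete:
  assumes "ws \<in> lists S" "t \<in> carrier W" "odd_at (wp ws) t"
  obtains us s vs where "ws = us @ s # vs" "t \<otimes> wp ws = wp (us @ vs)"
  using odd_inv_delete[of ws t] odd_at_wp[of ws t] assms
  by (metis S_square in_listsD lists_S_carrier)

lemma odd_at_imp_less:
  assumes "w \<in> carrier W" "t \<in> carrier W" "odd_at w t"
  shows "ell (t \<otimes> w) < ell w"
proof -
  obtain ws where ws: "ws \<in> lists S" "wp ws = w" "length ws = ell w"
    using assms reduced_exists by metis
  then obtain us s vs where "ws = us @ s # vs" "t \<otimes> w = wp (us @ vs)"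
    using odd_at_delete assms by metis
  then show ?thesis using ws ell_le[of "us @ vs"] by simp
qed

lemma odd_at_reflection_mult:
  assumes "w \<in> carrier W" "t \<in> reflections W S"
  shows "odd_at (t \<otimes> w) t \<longleftrightarrow> \<not> odd_at w t"
proof -
  have t: "t \<in> carrier W" "t \<otimes> t = \<one>"
    using assms reflections_carrier reflection_square by auto
  then have "inv t \<otimes> t \<otimes> t = t" by simp
  then show ?thesis using odd_at_mult[of t w t] odd_at_self assms t by simp
qed

text \<open>Odd parity allows a letter to be deleted from a reduced word, which shortens
  \<open>w\<close>. Even parity at \<open>w\<close> is odd parity at \<open>t \<otimes> w\<close>,
  and the same argument applied there shows that \<open>t \<otimes> w\<close> is the longer
  element.\<close>

lemma odd_at_iff_less:
  assumes "w \<in> carrier W" "t \<in> reflections W S"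
  shows "odd_at w t \<longleftrightarrow> ell (t \<otimes> w) < ell w"
    and "\<not> odd_at w t \<longleftrightarrow> ell (t \<otimes> w) > ell w"
proof -
  have t: "t \<in> carrier W" "t \<otimes> t = \<one>"
    using assms reflections_carrier reflection_square by auto
  have "odd_at w t \<Longrightarrow> ell (t \<otimes> w) < ell w"
    using odd_at_imp_less assms t by blast
  moreover have "ell (t \<otimes> w) > ell w" if "\<not> odd_at w t"
    using odd_at_imp_less[of "t \<otimes> w" t] odd_at_reflection_mult that assms t
    by (simp flip: m_assoc)
  ultimately show "odd_at w t \<longleftrightarrow> ell (t \<otimes> w) < ell w"
    and "\<not> odd_at w t \<longleftrightarrow> ell (t \<otimes> w) > ell w"
    by (auto dest: less_asym)
qed

lemma ell_S_mult:
  assumes "s \<in> S" "w \<in> carrier W"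
  shows "ell (s \<otimes> w) = ell w + 1 \<or> ell (s \<otimes> w) + 1 = ell w"
proof -
  have "ell (s \<otimes> w) \<le> ell w + 1"
    using ell_mult_le[of s w] ell_S_le assms by fastforce
  moreover have "ell w \<le> ell (s \<otimes> w) + 1"
    using ell_mult_le[of s "s \<otimes> w"] ell_S_le[of s] assms by simp
  moreover have "ell (s \<otimes> w) \<noteq> ell w"
    using odd_at_iff_less[OF assms(2) S_reflections[OF assms(1)]] by linarith
  ultimately show ?thesis by linarith
qed

section \<open>Two simultaneous left descents\<close>

text \<open>The exchange step only deletes letters, so shortening a word over \<open>J\<close> never
  leaves \<open>J\<close>.\<close>

lemma reduced_word_in:
  assumes "J \<subseteq> S" "ws \<in> lists J"
  shows "\<exists>vs\<in>lists J. wp vs = wp ws \<and> length vs = ell (wp ws)"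
  using assms(2)
proof (induction ws rule: list.induct)
  case Nil
  then show ?case by (intro bexI[of _ "[]"]) auto
next
  case (Cons x ws)
  then obtain vs where vs: "vs \<in> lists J" "wp vs = wp ws" "length vs = ell (wp ws)"
    by auto
  have x: "x \<in> J" "x \<in> S" and vsS: "vs \<in> lists S" using Cons.prems vs(1) assms(1) by auto
  consider "ell (x \<otimes> wp vs) = ell (wp vs) + 1" | "ell (x \<otimes> wp vs) + 1 = ell (wp vs)"
    using ell_S_mult[of x "wp vs"] x vsS by auto
  then show ?case
  proof cases
    case 1
    then show ?thesis using x vs by (intro bexI[of _ "x # vs"]) auto
  next
    case 2
    then have "odd_at (wp vs) x"
      using odd_at_iff_less(1)[of "wp vs" x] x vsS S_reflections by simp
    then obtain us y zs where *: "vs = us @ y # zs" "x \<otimes> wp vs = wp (us @ zs)"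
      using odd_at_delete[of vs x] x vsS by auto
    then show ?thesis
      using 2 vs by (intro bexI[of _ "us @ zs"]) auto
  qed
qed

fun alt :: "'a \<Rightarrow> 'a \<Rightarrow> nat \<Rightarrow> 'a list" where
  "alt s t 0 = []"
| "alt s t (Suc n) = s # alt t s n"

lemma length_alt [simp]: "length (alt s t n) = n"
  by (induction s t n rule: alt.induct) auto

lemma alt_lists: "s \<in> J \<Longrightarrow> t \<in> J \<Longrightarrow> alt s t n \<in> lists J"
  by (induction s t n rule: alt.induct) auto

lemma alt_Suc_snoc: "alt s t (Suc n) = alt s t n @ [if even n then s else t]"
  by (induction s t n rule: alt.induct) auto

lemma alt_add: "alt s t (m + n) = alt s t m @ (if even m then alt s t n else alt t s n)"
  by (induction s t m rule: alt.induct) auto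

lemma not_reduced_square:
  assumes "us @ s # s # vs \<in> lists S"
  shows "ell (wp (us @ s # s # vs)) < length (us @ s # s # vs)"
  using assms ell_le[of "us @ vs"] by (simp add: word_prod_append)

text \<open>Two equal adjacent letters would cancel, so the letters of a reduced word over two
  generators must alternate.\<close>

lemma reduced_word_alt:
  assumes "x # ws \<in> lists {x, y}" "x \<in> S" "y \<in> S" "length (x # ws) = ell (wp (x # ws))"
  shows "x # ws = alt x y (length (x # ws))"
  using assms
proof (induction ws arbitrary: x y rule: list.induct)
  case Nil
  show ?case by simp
next
  case (Cons z zs)
  have in_S: "z # zs \<in> lists S" using Cons.prems by auto
  have "z \<noteq> x"
  proof
    assume "z = x"
    then show False
      using not_reduced_square[of "[]" x zs] Cons.prems(2,4) in_S by simp
  qed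
  then have z: "z = y" using Cons.prems by auto
  have "ell (wp (x # z # zs)) \<le> 1 + ell (wp (z # zs))"
    using ell_mult_le[of x "wp (z # zs)"] ell_S_le[of x] Cons.prems in_S by fastforce
  then have "length (z # zs) = ell (wp (z # zs))"
    using Cons.prems ell_le[OF in_S] by simp
  moreover have "z # zs \<in> lists {y, x}" using Cons.prems(1) by auto
  ultimately have "z # zs = alt y x (length (z # zs))"
    using Cons.IH[of y x] Cons.prems(2,3) unfolding z by (simp only:)
  then show ?case by simp
qed

text \<open>At most one positive length can carry both a braid equality and a reduced alternating
  word: exchanging the first \<open>k\<close> letters of a longer one by the equality produces a
  repeated letter.\<close>

lemma alt_eq_unique:
  assumes S: "s \<in> S" "t \<in> S"
    and eq: "wp (alt s t k) = wp (alt t s k)" and red: "ell (wp (alt s t n)) = n"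
    and k: "0 < k" "k < n"
  shows False
proof -
  obtain i where i: "k = Suc i" using k by (cases k) auto
  obtain j where j: "n = k + Suc j" using k less_iff_Suc_add by auto
  \<comment> \<open>\<open>x\<close> is both the letter that follows \<open>alt s t k\<close> in the
    longer word and the last letter of \<open>alt t s k\<close>, so it is doubled after the
    exchange.\<close>
  define x y where "x = (if even k then s else t)" and "y = (if even k then t else s)"
  have xy: "x \<in> S" "y \<in> S" using S by (auto simp: x_def y_def)
  have w: "alt s t n = alt s t k @ alt x y (Suc j)"
    unfolding j alt_add x_def y_def by simp
  have w': "alt t s k = alt t s i @ [x]"
    unfolding i alt_Suc_snoc x_def by simp
  have "wp (alt s t n) = wp (alt t s k) \<otimes> wp (alt x y (Suc j))"
    unfolding w using eq S xy
    by (simp add: word_prod_append alt_lists del: alt.simps)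
  also have "\<dots> = wp (alt t s k @ alt x y (Suc j))"
    using S xy by (simp add: word_prod_append alt_lists del: alt.simps)
  also have "alt t s k @ alt x y (Suc j) = alt t s i @ x # x # alt y x j"
    unfolding w' by simp
  finally have "n < length (alt t s i @ x # x # alt y x j)"
    using not_reduced_square[of "alt t s i" x "alt y x j"] S xy red by (auto simp: alt_lists)
  then show False using i j by simp
qed

text \<open>The weak order in additive form on natural numbers, with membership in the carrier built
  in. On the carrier it agrees with \<open>weak_order\<close>, see
  \<open>weak_order_le\<close>.\<close>

definition below :: "'a \<Rightarrow> 'a \<Rightarrow> bool" (infix "\<preceq>" 50) where
  "x \<preceq> y \<longleftrightarrow> x \<in> carrier W \<and> y \<in> carrier W \<and> ell x + ell (inv x \<otimes> y) = ell y"

lemma below_carrier: "x \<preceq> y \<Longrightarrow> x \<in> carrier W" "x \<preceq> y \<Longrightarrow> y \<in> carrier W"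
  by (auto simp: below_def)

lemma below_mult:
  "x \<in> carrier W \<Longrightarrow> y \<in> carrier W \<Longrightarrow> x \<preceq> x \<otimes> y \<longleftrightarrow> ell (x \<otimes> y) = ell x + ell y"
  by (auto simp: below_def)

lemma ell_le_add_quotient:
  "x \<in> carrier W \<Longrightarrow> y \<in> carrier W \<Longrightarrow> ell y \<le> ell x + ell (inv x \<otimes> y)"
  using ell_mult_le[of x "inv x \<otimes> y"] by simp

lemma below_refl: "x \<in> carrier W \<Longrightarrow> x \<preceq> x"
  by (simp add: below_def)

lemma below_chain:
  assumes "x \<preceq> y" "y \<preceq> z"
  shows "x \<preceq> z" "ell (inv x \<otimes> z) = ell (inv x \<otimes> y) + ell (inv y \<otimes> z)"
proof -
  have c: "x \<in> carrier W" "y \<in> carrier W" "z \<in> carrier W"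
    using assms by (auto simp: below_def)
  have "inv x \<otimes> z = (inv x \<otimes> y) \<otimes> (inv y \<otimes> z)" using c by (simp add: m_assoc)
  then have "ell (inv x \<otimes> z) \<le> ell (inv x \<otimes> y) + ell (inv y \<otimes> z)"
    using c ell_mult_le by simp
  then have "ell (inv x \<otimes> z) = ell (inv x \<otimes> y) + ell (inv y \<otimes> z) \<and>
      ell x + ell (inv x \<otimes> z) = ell z"
    using assms ell_le_add_quotient[of x z] c by (auto simp: below_def)
  then show "x \<preceq> z" "ell (inv x \<otimes> z) = ell (inv x \<otimes> y) + ell (inv y \<otimes> z)"
    using c by (auto simp: below_def)
qed

text \<open>Splitting \<open>z\<close> into \<open>u\<close>, \<open>d\<close> and a remainder gives
  three lengths that add up to \<open>ell z\<close>. Subadditivity then leaves no slack in either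
  inequality for \<open>u \<otimes> d\<close>.\<close>

lemma below_translate:
  assumes "u \<preceq> z" "d \<preceq> inv u \<otimes> z"
  shows "u \<preceq> u \<otimes> d" "u \<otimes> d \<preceq> z"
proof -
  have c: "u \<in> carrier W" "d \<in> carrier W" "z \<in> carrier W"
    using assms by (auto simp: below_def)
  have "inv (u \<otimes> d) \<otimes> z = inv d \<otimes> (inv u \<otimes> z)"
    using c by (simp add: inv_mult_group m_assoc)
  then have "ell (u \<otimes> d) = ell u + ell d \<and> ell (u \<otimes> d) + ell (inv (u \<otimes> d) \<otimes> z) = ell z"
    using assms c ell_mult_le[of u d] ell_le_add_quotient[of "u \<otimes> d" z]
    by (auto simp: below_def)
  then show "u \<preceq> u \<otimes> d" "u \<otimes> d \<preceq> z" using c by (auto simp: below_def)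
qed

lemma left_descent_below:
  assumes "s \<in> S" "w \<in> carrier W" "ell (s \<otimes> w) < ell w"
  shows "s \<preceq> w"
proof -
  have "ell (s \<otimes> w) + 1 = ell w" using ell_S_mult[of s w] assms by auto
  moreover have "ell s = 1"
    using ell_le_add_quotient[of s w] ell_S_le[of s] assms by fastforce
  ultimately show ?thesis using assms by (simp add: below_def)
qed

text \<open>
  The element \<open>w\<close> is split as \<open>a b\<close> with \<open>a\<close> in the subgroup generated by \<open>J\<close> and
  \<open>b\<close> of minimal length in the coset, so that the exchange property never deletes from \<open>b\<close>.
\<close>

lemma coset_decomposition:
  assumes J: "J \<subseteq> S" and w: "w \<in> carrier W"
  shows "\<exists>us\<in>lists J. wp us \<preceq> w \<and>
    (\<forall>x\<in>J. ell (x \<otimes> w) < ell w \<longrightarrow> ell (x \<otimes> wp us) < ell (wp us))"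
proof -
  have JS: "us \<in> lists J \<Longrightarrow> us \<in> lists S" for us using J by auto
  define B where "B b \<longleftrightarrow> b \<in> carrier W \<and> (\<exists>us\<in>lists J. wp us \<otimes> b = w)" for b
  have "B w" using w by (auto simp: B_def intro!: bexI[of _ "[]"])
  then obtain b where "B b" and b_min: "\<And>b'. B b' \<Longrightarrow> ell b \<le> ell b'"
    using ex_has_least_nat[of B w ell] by blast
  then obtain us where us: "us \<in> lists J" "wp us \<otimes> b = w" and b: "b \<in> carrier W"
    unfolding B_def by blast
  have rev: "rev vs \<in> lists J \<and> wp (rev vs) = inv (wp vs)" if "vs \<in> lists J" for vs
    using that
  proof (induction vs rule: list.induct)
    case (Cons x vs)
    then have "x \<in> S" "rev vs \<in> lists S" "vs \<in> lists S" using J JS by auto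
    then show ?case using Cons by (simp add: word_prod_append inv_mult_group)
  qed simp
  have coset_min: "ell b \<le> ell (wp vs \<otimes> b)" if vs: "vs \<in> lists J" for vs
  proof (rule b_min)
    have "wp (us @ rev vs) \<otimes> (wp vs \<otimes> b) = w"
      using vs us b JS rev[OF vs] by (simp add: word_prod_append m_assoc)
    moreover have "us @ rev vs \<in> lists J" using us rev[OF vs] by simp
    moreover have "wp vs \<otimes> b \<in> carrier W" using b JS[OF vs] by simp
    ultimately show "B (wp vs \<otimes> b)" unfolding B_def by metis
  qed
  \<comment> \<open>The conjugate of \<open>x\<close> by \<open>inv (wp vs)\<close> lies in the
    subgroup generated by \<open>J\<close>, so by minimality it does not shorten \<open>b\<close>.
    By the cocycle rule the odd parity at \<open>x\<close> must then come from
    \<open>wp vs\<close>.\<close>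
  have descent: "ell (x \<otimes> wp vs) < ell (wp vs)"
    if vs: "vs \<in> lists J" and x: "x \<in> J" and less: "ell (x \<otimes> (wp vs \<otimes> b)) < ell (wp vs \<otimes> b)" for vs x
  proof -
    have xS: "x \<in> S" using x J by blast
    have vsW: "wp vs \<in> carrier W" using vs JS by auto
    let ?r = "inv (wp vs) \<otimes> x \<otimes> inv (inv (wp vs))"
    have r: "?r \<in> reflections W S"
      using reflection_conj[OF S_reflections[OF xS], of "inv (wp vs)"] vsW by simp
    have "?r = wp (rev vs @ x # vs)"
      using vs JS rev[OF vs] xS vsW by (simp add: word_prod_append m_assoc)
    moreover have "rev vs @ x # vs \<in> lists J" using vs x rev[OF vs] by simp
    ultimately have "ell b \<le> ell (?r \<otimes> b)" using coset_min by metis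
    then have "\<not> odd_at b ?r" using odd_at_iff_less(1)[OF b r] by simp
    moreover have "odd_at (wp vs \<otimes> b) x"
      using odd_at_iff_less(1)[of "wp vs \<otimes> b" x] less b vsW xS S_reflections by simp
    ultimately have "odd_at (wp vs) x"
      using odd_at_mult[of "wp vs" b x] vsW b xS by simp
    then show ?thesis
      using odd_at_iff_less(1)[of "wp vs" x] vsW xS S_reflections by simp
  qed
  \<comment> \<open>A letter that failed to raise the length in front of \<open>b\<close> would, by
    \<open>descent\<close>, already shorten the word after it, against reducedness.\<close>
  have additive: "ell (wp vs \<otimes> b) = length vs + ell b"
    if "vs \<in> lists J" "length vs = ell (wp vs)" for vs
    using that
  proof (induction vs rule: list.induct)
    case (Cons x vs)
    have xS: "x \<in> S" and vs: "vs \<in> lists J" "vs \<in> lists S" using Cons.prems J by auto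
    have "ell (wp vs) = length vs"
      using ell_S_mult[of x "wp vs"] ell_le[of vs] Cons.prems xS vs by auto
    moreover from this have "\<not> ell (x \<otimes> (wp vs \<otimes> b)) < ell (wp vs \<otimes> b)"
      using descent[of vs x] Cons.prems vs by auto
    ultimately show ?case
      using Cons.IH vs ell_S_mult[of x "wp vs \<otimes> b"] xS b by (auto simp: m_assoc)
  qed (use b in simp)
  obtain vs where vs: "vs \<in> lists J" "wp vs = wp us" "length vs = ell (wp us)"
    using reduced_word_in[OF J us(1)] by blast
  have "wp us \<in> carrier W" using JS[OF us(1)] by simp
  then have "wp us \<preceq> w"
    using additive[of vs] vs b by (simp add: below_mult flip: us(2))
  moreover have "\<forall>x\<in>J. ell (x \<otimes> w) < ell w \<longrightarrow> ell (x \<otimes> wp us) < ell (wp us)"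
    using descent[OF us(1)] by (simp add: us(2))
  ultimately show ?thesis using us(1) by blast
qed

text \<open>The component of \<open>w\<close> in the subgroup generated by \<open>s\<close> and
  \<open>t\<close> inherits both descents. It thus has a reduced word beginning with each generator,
  and both words alternate.\<close>

lemma two_left_descents:
  assumes S: "s \<in> S" "t \<in> S" and w: "w \<in> carrier W"
    and desc: "ell (s \<otimes> w) < ell w" "ell (t \<otimes> w) < ell w"
  obtains k where "0 < k" "wp (alt s t k) = wp (alt t s k)" "ell (wp (alt s t k)) = k"
    "wp (alt s t k) \<preceq> w"
proof -
  obtain us where us: "us \<in> lists {s, t}" "wp us \<preceq> w"
    and d: "ell (s \<otimes> wp us) < ell (wp us)" "ell (t \<otimes> wp us) < ell (wp us)"
    using coset_decomposition[of "{s, t}" w] S w desc by auto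
  define k where "k = ell (wp us)"
  have usS: "us \<in> lists S" using us(1) S by auto
  have alt: "wp us = wp (alt x y k)"
    \<comment> \<open>Reducing \<open>x \<otimes> wp us\<close> inside the two generators and
      putting \<open>x\<close> back in front gives a reduced word for \<open>wp us\<close> that
      begins with \<open>x\<close>.\<close>
    if xy: "{x, y} = {s, t}" and less: "ell (x \<otimes> wp us) < ell (wp us)" for x y
  proof -
    have x: "x \<in> S" "y \<in> S" using xy S by (metis doubleton_eq_iff)+
    have "x # us \<in> lists {s, t}" using us(1) xy by auto
    then obtain vs where vs: "vs \<in> lists {s, t}" "wp vs = x \<otimes> wp us" "length vs = ell (x \<otimes> wp us)"
      using reduced_word_in[of "{s, t}" "x # us"] S by auto
    have eq: "wp (x # vs) = wp us" using vs(2) x usS by simp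
    have len: "length (x # vs) = k"
      using ell_S_mult[of x "wp us"] less x usS vs(3) by (auto simp: k_def)
    have "x # vs = alt x y (length (x # vs))"
      using vs(1) xy x eq len by (intro reduced_word_alt) (auto simp: k_def)
    then show ?thesis using eq len by metis
  qed
  show thesis
  proof (rule that[of k])
    show "0 < k" using d(1) by (simp add: k_def)
    show "wp (alt s t k) = wp (alt t s k)" using alt[of s t] alt[of t s] d by auto
    show "ell (wp (alt s t k)) = k" "wp (alt s t k) \<preceq> w"
      using alt[OF HOL.refl d(1)] us(2) k_def by metis+
  qed
qed

section \<open>Joins in the weak order\<close>

definition is_join :: "'a \<Rightarrow> 'a \<Rightarrow> 'a \<Rightarrow> bool" where
  "is_join x y j \<longleftrightarrow> x \<preceq> j \<and> y \<preceq> j \<and> (\<forall>z. x \<preceq> z \<longrightarrow> y \<preceq> z \<longrightarrow> j \<preceq> z)"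

text \<open>The given \<open>w\<close> only serves to produce the braid equality of length
  \<open>k\<close>. Any other \<open>v\<close> with both descents yields some length
  \<open>l\<close>, and \<open>alt_eq_unique\<close> forces \<open>l = k\<close>, so one element
  lies below every such \<open>v\<close>.\<close>

lemma join_of_two_generators:
  assumes S: "s \<in> S" "t \<in> S" and w: "w \<in> carrier W"
    and desc: "ell (s \<otimes> w) < ell w" "ell (t \<otimes> w) < ell w"
  shows "\<exists>d. s \<preceq> d \<and> t \<preceq> d \<and>
    (\<forall>v\<in>carrier W. ell (s \<otimes> v) < ell v \<longrightarrow> ell (t \<otimes> v) < ell v \<longrightarrow> d \<preceq> v)"
proof -
  obtain k where k: "0 < k" "wp (alt s t k) = wp (alt t s k)" "ell (wp (alt s t k)) = k"
    using two_left_descents[OF S w desc] by blast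
  have alt_S: "alt s t i \<in> lists S" "alt t s i \<in> lists S" for i
    using S by (simp_all add: alt_lists)
  have below: "x \<preceq> wp (alt x y k)"
    if "x \<in> S" "alt y x (k - 1) \<in> lists S" "ell (wp (alt x y k)) = k" for x y
  proof (rule left_descent_below)
    have "alt x y k = x # alt y x (k - 1)" using k(1) by (cases k) auto
    then have "x \<otimes> wp (alt x y k) = wp (alt y x (k - 1))" "wp (alt x y k) \<in> carrier W"
      using that by simp_all
    then show "ell (x \<otimes> wp (alt x y k)) < ell (wp (alt x y k))" "wp (alt x y k) \<in> carrier W"
      using ell_le[OF that(2)] that(3) k(1) by simp_all
  qed (use that in simp)
  have "wp (alt s t k) \<preceq> v"
    if v: "v \<in> carrier W" "ell (s \<otimes> v) < ell v" "ell (t \<otimes> v) < ell v" for v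
  proof -
    obtain l where l: "0 < l" "wp (alt s t l) = wp (alt t s l)" "ell (wp (alt s t l)) = l"
      "wp (alt s t l) \<preceq> v"
      using two_left_descents[OF S v] by blast
    have "k = l"
      using alt_eq_unique[OF S k(2) l(3) k(1)] alt_eq_unique[OF S l(2) k(3) l(1)]
      by (meson linorder_neqE_nat)
    then show ?thesis using l(4) by simp
  qed
  then show ?thesis
    using below[of s t] below[of t s] k S alt_S by metis
qed

lemma left_descent_quotient:
  assumes "s \<in> S" "u \<preceq> u \<otimes> s" "u \<otimes> s \<preceq> z"
  shows "ell (s \<otimes> (inv u \<otimes> z)) < ell (inv u \<otimes> z)"
proof -
  have c: "u \<in> carrier W" "z \<in> carrier W" using assms by (auto simp: below_def)
  have "inv (u \<otimes> s) \<otimes> z = s \<otimes> (inv u \<otimes> z)"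
    using c assms(1) by (simp add: inv_mult_group m_assoc)
  then have "ell (inv u \<otimes> z) = ell s + ell (s \<otimes> (inv u \<otimes> z))"
    using below_chain(2)[OF assms(2,3)] c assms(1) by simp
  then show ?thesis
    using ell_S_mult[of s "inv u \<otimes> z"] assms(1) c by auto
qed

text \<open>If \<open>z\<close> lies above both covers, then \<open>inv u \<otimes> z\<close> has
  \<open>s\<close> and \<open>t\<close> as left descents and so lies above the join \<open>d\<close>
  of the two generators. Translating back, \<open>u \<otimes> d\<close> is the join of the
  covers.\<close>

lemma join_of_covers:
  assumes S: "s \<in> S" "t \<in> S"
    and u: "u \<preceq> u \<otimes> s" "u \<preceq> u \<otimes> t" and z: "u \<otimes> s \<preceq> z" "u \<otimes> t \<preceq> z"
  shows "\<exists>j. is_join (u \<otimes> s) (u \<otimes> t) j"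
proof -
  have c: "u \<in> carrier W" "z \<in> carrier W" using u z by (auto simp: below_def)
  obtain d where d: "s \<preceq> d" "t \<preceq> d" and least: "\<And>v. v \<in> carrier W \<Longrightarrow>
      ell (s \<otimes> v) < ell v \<Longrightarrow> ell (t \<otimes> v) < ell v \<Longrightarrow> d \<preceq> v"
    using join_of_two_generators[OF S, of "inv u \<otimes> z"] left_descent_quotient S u z c
    by (metis inv_closed m_closed)
  have dz: "d \<preceq> inv u \<otimes> z'" if "u \<otimes> s \<preceq> z'" "u \<otimes> t \<preceq> z'" for z'
    using that least left_descent_quotient S u c by (meson below_carrier inv_closed m_closed)
  have ud: "u \<preceq> u \<otimes> d"
    using below_translate(1)[OF below_chain(1)[OF u(1) z(1)] dz[OF z]] .
  have "d \<in> carrier W" using d below_carrier by blast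
  then have "s \<preceq> inv u \<otimes> (u \<otimes> d)" "t \<preceq> inv u \<otimes> (u \<otimes> d)" using d c by simp_all
  then have "u \<otimes> s \<preceq> u \<otimes> d" "u \<otimes> t \<preceq> u \<otimes> d"
    using below_translate(2)[OF ud] by blast+
  moreover have "u \<otimes> d \<preceq> z'" if "u \<otimes> s \<preceq> z'" "u \<otimes> t \<preceq> z'" for z'
    using below_translate(2)[OF below_chain(1)[OF u(1) that(1)] dz[OF that]] .
  ultimately show ?thesis unfolding is_join_def by blast
qed

text \<open>The generator is the first letter of a reduced word for
  \<open>inv u \<otimes> x\<close>.\<close>

lemma below_cover:
  assumes "u \<preceq> x" "u \<noteq> x"
  obtains s where "s \<in> S" "u \<preceq> u \<otimes> s" "u \<otimes> s \<preceq> x" "ell u < ell (u \<otimes> s)"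
proof -
  have c: "u \<in> carrier W" "x \<in> carrier W" using assms by (auto simp: below_def)
  let ?v = "inv u \<otimes> x"
  have v: "?v \<in> carrier W" using c by simp
  obtain ws where ws: "ws \<in> lists S" "wp ws = ?v" "length ws = ell ?v"
    using reduced_exists[OF v] by blast
  have "ws \<noteq> []"
    using ws(2) assms(2) c by (metis cancel_inv r_one word_prod_Nil)
  then obtain s vs where sv: "ws = s # vs" by (cases ws) auto
  then have s: "s \<in> S" "vs \<in> lists S" using ws(1) by auto
  have "s \<otimes> ?v = wp vs" using ws(2)[symmetric] sv s by simp
  then have desc: "ell (s \<otimes> ?v) < ell ?v" using ell_le[OF s(2)] ws(3) sv by simp
  then have sv: "s \<preceq> ?v" using left_descent_below s v by blast
  have us: "u \<preceq> u \<otimes> s" "u \<otimes> s \<preceq> x"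
    using below_translate[OF assms(1) sv] by blast+
  have "ell s \<noteq> 0"
  proof
    assume "ell s = 0"
    then have "s \<otimes> ?v = ?v" using ell_eq_0[of s] s(1) v by simp
    then show False using desc by simp
  qed
  then have "ell u < ell (u \<otimes> s)"
    using us(1) c s by (simp add: below_mult)
  then show ?thesis using that s us by blast
qed

text \<open>
  The join of \<open>x\<close> and \<open>y\<close> is reached through the join \<open>c\<close> of two covers \<open>u s \<preceq> x\<close> and
  \<open>u t \<preceq> y\<close> of a common lower bound: first \<open>x\<close> is joined with \<open>c\<close> above \<open>u s\<close>, then the result
  with \<open>y\<close> above \<open>u t\<close>, and both pairs have a longer lower bound.
\<close>

lemma join_above_exists:
  assumes "u \<preceq> x" "u \<preceq> y" "x \<preceq> z" "y \<preceq> z"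
  shows "\<exists>j. is_join x y j"
  using assms
proof (induction "ell z - ell u" arbitrary: u x y rule: less_induct)
  case less
  show ?case
  proof (cases "u = x \<or> u = y")
    case True
    then show ?thesis using less.prems below_refl below_carrier unfolding is_join_def by metis
  next
    case False
    obtain s where s: "s \<in> S" "u \<preceq> u \<otimes> s" "u \<otimes> s \<preceq> x" "ell u < ell (u \<otimes> s)"
      using below_cover less.prems(1) False by blast
    obtain t where t: "t \<in> S" "u \<preceq> u \<otimes> t" "u \<otimes> t \<preceq> y" "ell u < ell (u \<otimes> t)"
      using below_cover less.prems(2) False by blast
    have z: "u \<otimes> s \<preceq> z" "u \<otimes> t \<preceq> z"
      using s t less.prems below_chain(1) by blast+
    then have dec: "ell z - ell (u \<otimes> s) < ell z - ell u" "ell z - ell (u \<otimes> t) < ell z - ell u"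
      using s(4) t(4) by (auto simp: below_def)
    obtain c where c: "is_join (u \<otimes> s) (u \<otimes> t) c"
      using join_of_covers[OF s(1) t(1) s(2) t(2) z] by blast
    then have c': "u \<otimes> s \<preceq> c" "u \<otimes> t \<preceq> c" "c \<preceq> z" using z unfolding is_join_def by blast+
    obtain a where a: "is_join x c a"
      using less.hyps[OF dec(1) s(3) c'(1) less.prems(3) c'(3)] by blast
    then have a': "x \<preceq> a" "c \<preceq> a" "a \<preceq> z" using c' less.prems unfolding is_join_def by blast+
    obtain j where j: "is_join a y j"
      using less.hyps[OF dec(2) below_chain(1)[OF c'(2) a'(2)] t(3) a'(3) less.prems(4)] by blast
    have "j \<preceq> z'" if z': "x \<preceq> z'" "y \<preceq> z'" for z'
    proof -
      have "u \<otimes> s \<preceq> z'" "u \<otimes> t \<preceq> z'" using z' s(3) t(3) below_chain(1) by blast+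
      then have "c \<preceq> z'" using c unfolding is_join_def by blast
      then have "a \<preceq> z'" using a z' unfolding is_join_def by blast
      then show ?thesis using j z' unfolding is_join_def by blast
    qed
    then have "is_join x y j"
      using j below_chain(1)[OF a'(1)] unfolding is_join_def by blast
    then show ?thesis by blast
  qed
qed

lemma join_exists:
  assumes "x \<preceq> z" "y \<preceq> z"
  shows "\<exists>j. is_join x y j"
proof (rule join_above_exists[OF _ _ assms])
  show "\<one> \<preceq> x" "\<one> \<preceq> y" using assms by (auto simp: below_def)
qed

section \<open>Gates, convexity and half-spaces under intersection and translation\<close>

lemma weak_order_le:
  "x \<in> carrier W \<Longrightarrow> y \<in> carrier W \<Longrightarrow> le (weak_order W S) x y \<longleftrightarrow> x \<preceq> y"
  by (auto simp: weak_order_def below_def)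

lemma carrier_weak_order [simp]: "carrier (weak_order W S) = carrier W"
  by (simp add: weak_order_def)

lemma is_gate_iff: "is_gate W S g Y \<longleftrightarrow> Y \<subseteq> carrier W \<and> g \<in> Y \<and> (\<forall>y\<in>Y. g \<preceq> y)"
  using weak_order_le by (auto simp: is_gate_def least_def subset_iff)

lemma is_gate_subset: "is_gate W S g Y \<Longrightarrow> Z \<subseteq> Y \<Longrightarrow> g \<in> Z \<Longrightarrow> is_gate W S g Z"
  by (auto simp: is_gate_iff)

lemma Upper_pair:
  "x \<in> carrier W \<Longrightarrow> y \<in> carrier W \<Longrightarrow> Upper (weak_order W S) {x, y} = {z. x \<preceq> z \<and> y \<preceq> z}"
  using weak_order_le by (auto simp: Upper_def below_carrier)

lemma least_Upper_pair:
  assumes "x \<in> carrier W" "y \<in> carrier W"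
  shows "least (weak_order W S) j (Upper (weak_order W S) {x, y}) \<longleftrightarrow> is_join x y j"
  using weak_order_le below_carrier
  by (auto simp: least_def Upper_pair[OF assms] is_join_def)

text \<open>The supremum operation picks some least upper bound by \<open>SOME\<close>, so it has
  the defining property once a join exists.\<close>

lemma is_join_sup:
  assumes "is_join x y j"
  shows "is_join x y (x \<squnion>\<^bsub>weak_order W S\<^esub> y)"
proof -
  have c: "x \<in> carrier W" "y \<in> carrier W"
    using assms below_carrier by (auto simp: is_join_def)
  show ?thesis
    unfolding join_def sup_def least_Upper_pair[OF c] using assms by (rule someI)
qed

text \<open>Reduced words for \<open>inv x \<otimes> h\<close> and \<open>inv h \<otimes> y\<close>
  concatenate to a reduced word for \<open>inv x \<otimes> y\<close>, whose path from
  \<open>x\<close> passes through \<open>h\<close>.\<close>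

lemma convex_between:
  assumes Y: "convex_subset W S Y" "x \<in> Y" "y \<in> Y" and h: "x \<preceq> h" "h \<preceq> y"
  shows "h \<in> Y"
proof -
  have c: "x \<in> carrier W" "h \<in> carrier W" "y \<in> carrier W"
    using h by (auto simp: below_def)
  obtain us where us: "us \<in> lists S" "wp us = inv x \<otimes> h" "length us = ell (inv x \<otimes> h)"
    using reduced_exists[of "inv x \<otimes> h"] c by auto
  obtain vs where vs: "vs \<in> lists S" "wp vs = inv h \<otimes> y" "length vs = ell (inv h \<otimes> y)"
    using reduced_exists[of "inv h \<otimes> y"] c by auto
  have "reduced_expression W S (us @ vs) (inv x \<otimes> y)"
    using us vs below_chain(2)[OF h] c
    by (simp add: reduced_expression_def word_prod_append m_assoc)
  then have "x \<otimes> wp (take (length us) (us @ vs)) \<in> Y"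
    using Y unfolding convex_subset_def by (metis le_add1 length_append)
  then show ?thesis using us c by simp
qed

lemma convex_Int: "convex_subset W S A \<Longrightarrow> convex_subset W S B \<Longrightarrow> convex_subset W S (A \<inter> B)"
  by (auto simp: convex_subset_def)

lemma mem_l_coset_iff:
  "x \<in> carrier W \<Longrightarrow> Y \<subseteq> carrier W \<Longrightarrow> y \<in> x <# Y \<longleftrightarrow> y \<in> carrier W \<and> inv x \<otimes> y \<in> Y"
  unfolding l_coset_def by (auto intro!: bexI[of _ "inv x \<otimes> y"])

text \<open>Left translation leaves the quotients \<open>inv x \<otimes> y\<close>, and hence their
  reduced words, unchanged.\<close>

lemma convex_l_coset:
  assumes Y: "convex_subset W S Y" and a: "a \<in> carrier W"
  shows "convex_subset W S (a <# Y)"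
  unfolding convex_subset_def
proof (intro conjI ballI allI impI)
  have YW: "Y \<subseteq> carrier W" using Y by (simp add: convex_subset_def)
  then show "a <# Y \<subseteq> carrier W" using a by (auto simp: mem_l_coset_iff)
  fix x y ws j
  assume xy: "x \<in> a <# Y" "y \<in> a <# Y" and red: "reduced_expression W S ws (inv x \<otimes> y)"
    and j: "j \<le> length ws"
  have c: "x \<in> carrier W" "y \<in> carrier W" and in_Y: "inv a \<otimes> x \<in> Y" "inv a \<otimes> y \<in> Y"
    using xy a YW by (auto simp: mem_l_coset_iff)
  have "inv (inv a \<otimes> x) \<otimes> (inv a \<otimes> y) = inv x \<otimes> y"
    using a c by (simp add: inv_mult_group m_assoc)
  then have "inv a \<otimes> x \<otimes> wp (take j ws) \<in> Y"
    using Y in_Y red j by (simp add: convex_subset_def)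
  moreover have "wp (take j ws) \<in> carrier W"
    using red set_take_subset[of j ws]
    by (intro word_prod_closed lists_S_carrier) (auto simp: reduced_expression_def)
  ultimately show "x \<otimes> wp (take j ws) \<in> a <# Y"
    using a c YW by (simp add: mem_l_coset_iff m_assoc)
qed

lemma is_gate_Int:
  assumes A: "convex_subset W S A" "is_gate W S a A"
    and B: "convex_subset W S B" "is_gate W S b B"
    and ne: "A \<inter> B \<noteq> {}"
  shows "bounded_subset W S {a, b}" "is_gate W S (a \<squnion>\<^bsub>weak_order W S\<^esub> b) (A \<inter> B)"
proof -
  have a: "A \<subseteq> carrier W" "a \<in> A" "\<And>y. y \<in> A \<Longrightarrow> a \<preceq> y"
    and b: "B \<subseteq> carrier W" "b \<in> B" "\<And>y. y \<in> B \<Longrightarrow> b \<preceq> y"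
    using A B by (auto simp: is_gate_iff)
  obtain z where z: "z \<in> A" "z \<in> B" using ne by blast
  have c: "a \<in> carrier W" "b \<in> carrier W" using a b by blast+
  show "bounded_subset W S {a, b}"
    unfolding bounded_subset_def Upper_pair[OF c] using a b z c by blast
  let ?j = "a \<squnion>\<^bsub>weak_order W S\<^esub> b"
  have j: "is_join a b ?j"
    using join_exists[OF a(3)[OF z(1)] b(3)[OF z(2)]] is_join_sup by blast
  then have "a \<preceq> ?j" "b \<preceq> ?j" and below: "\<And>y. y \<in> A \<inter> B \<Longrightarrow> ?j \<preceq> y"
    using a b unfolding is_join_def by blast+
  \<comment> \<open>The join lies between \<open>a\<close> and \<open>z\<close> and also between
    \<open>b\<close> and \<open>z\<close>, so each convex set contains it.\<close>
  then have "?j \<in> A \<inter> B"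
    using convex_between[OF A(1) a(2) z(1)] convex_between[OF B(1) b(2) z(2)] z by blast
  then show "is_gate W S ?j (A \<inter> B)"
    unfolding is_gate_iff using a(1) below by blast
qed

section \<open>Left descents, and translation of gates and half-spaces by a generator\<close>

lemma mem_left_descents_iff:
  "w \<in> carrier W \<Longrightarrow> s \<in> left_descents W S w \<longleftrightarrow> s \<in> S \<and> ell (s \<otimes> w) < ell w"
  using ell_S_mult[of s w] by (auto simp: left_descents_def)

lemma left_descents_flip:
  "w \<in> carrier W \<Longrightarrow> s \<in> S \<Longrightarrow> s \<in> left_descents W S (s \<otimes> w) \<longleftrightarrow> s \<notin> left_descents W S w"
  using ell_S_mult[of s w] by (auto simp: mem_left_descents_iff)

text \<open>Multiplication by \<open>s\<close> shortens every element of \<open>Q\<close> by exactly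
  one and preserves quotients, so the additivity of lengths that expresses
  \<open>q \<preceq> y\<close> survives.\<close>

lemma is_gate_l_coset:
  assumes s: "s \<in> S" and Q: "is_gate W S q Q"
    and desc: "\<And>y. y \<in> Q \<Longrightarrow> s \<in> left_descents W S y"
  shows "is_gate W S (s \<otimes> q) (s <# Q)"
  unfolding is_gate_iff
proof (intro conjI ballI)
  have q: "Q \<subseteq> carrier W" "q \<in> Q" "q \<in> carrier W" "\<And>y. y \<in> Q \<Longrightarrow> q \<preceq> y"
    using Q by (auto simp: is_gate_iff)
  show "s <# Q \<subseteq> carrier W" "s \<otimes> q \<in> s <# Q"
    using s q by (auto simp: mem_l_coset_iff)
  fix y assume "y \<in> s <# Q"
  then have y: "y \<in> carrier W" "s \<otimes> y \<in> Q" using s q by (auto simp: mem_l_coset_iff)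
  have "ell (s \<otimes> q) + 1 = ell q" "ell y + 1 = ell (s \<otimes> y)"
    using desc[OF q(2)] desc[OF y(2)] ell_S_mult[of s q] ell_S_mult[of s "s \<otimes> y"] s q y
    by (auto simp: mem_left_descents_iff)
  moreover have "inv (s \<otimes> q) \<otimes> y = inv q \<otimes> (s \<otimes> y)"
    using s q y by (simp add: inv_mult_group m_assoc)
  ultimately show "s \<otimes> q \<preceq> y"
    using q(4)[OF y(2)] s q(3) y(1) by (simp add: below_def)
qed

text \<open>With \<open>b\<close> choosing the side, both kinds of half-space become level sets of
  the parity, to which the cocycle rule applies directly.\<close>

lemma half_spaces_eq:
  "half_spaces W S = {{w \<in> carrier W. odd_at w r = b} | r b. r \<in> reflections W S}"
proof -
  have "{w \<in> carrier W. ell (r \<otimes> w) < ell w} = {w \<in> carrier W. odd_at w r = True}"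
    "{w \<in> carrier W. ell (r \<otimes> w) > ell w} = {w \<in> carrier W. odd_at w r = False}"
    if "r \<in> reflections W S" for r
    using odd_at_iff_less[OF _ that] by auto
  then have "half_spaces W S = (\<Union>r\<in>reflections W S.
      {{w \<in> carrier W. odd_at w r = False}, {w \<in> carrier W. odd_at w r = True}})"
    unfolding half_spaces_def by simp
  also have "\<dots> = {{w \<in> carrier W. odd_at w r = b} | r b. r \<in> reflections W S}"
    (is "?L = ?R")
  proof
    show "?L \<subseteq> ?R" by blast
    show "?R \<subseteq> ?L"
    proof
      fix H assume "H \<in> ?R"
      then obtain r b where "r \<in> reflections W S" "H = {w \<in> carrier W. odd_at w r = b}" by blast
      then show "H \<in> ?L" by (cases b) auto
    qed
  qed
  finally show ?thesis .
qed

text \<open>Translation replaces \<open>r\<close> by its conjugate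
  \<open>s \<otimes> r \<otimes> s\<close>, and by the cocycle rule the side is swapped exactly when
  \<open>r = s\<close>.\<close>

lemma half_space_l_coset:
  assumes s: "s \<in> S" and H: "H \<in> half_spaces W S"
  shows "s <# H \<in> half_spaces W S"
proof -
  obtain r b where r: "r \<in> reflections W S" and H: "H = {w \<in> carrier W. odd_at w r = b}"
    using H unfolding half_spaces_eq by blast
  have sr: "s \<otimes> r \<otimes> s \<in> reflections W S" using reflection_conj[OF r, of s] s by simp
  have "odd_at (s \<otimes> v) r \<longleftrightarrow> (r = s) \<noteq> odd_at v (s \<otimes> r \<otimes> s)" if "v \<in> carrier W" for v
    using odd_at_mult[of s v r] odd_at_S[of s r] s r that reflections_carrier by simp
  then have "s <# H = {v \<in> carrier W. odd_at v (s \<otimes> r \<otimes> s) = (b \<noteq> (r = s))}"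
    using s by (auto simp: H mem_l_coset_iff)
  then show ?thesis unfolding half_spaces_eq using sr by blast
qed

lemma half_space_intersection_Int:
  assumes "finite_half_space_intersection W S A" "finite_half_space_intersection W S B"
  shows "finite_half_space_intersection W S (A \<inter> B)"
proof -
  obtain F G where "finite F" "F \<subseteq> half_spaces W S" "A = carrier W \<inter> \<Inter>F"
    "finite G" "G \<subseteq> half_spaces W S" "B = carrier W \<inter> \<Inter>G"
    using assms unfolding finite_half_space_intersection_def by blast
  then show ?thesis
    unfolding finite_half_space_intersection_def by (intro exI[of _ "F \<union> G"]) auto
qed

lemma half_space_intersection_l_coset:
  assumes s: "s \<in> S" and A: "finite_half_space_intersection W S A"
  shows "finite_half_space_intersection W S (s <# A)"
proof -
  obtain F where F: "finite F" "F \<subseteq> half_spaces W S" "A = carrier W \<inter> \<Inter>F"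
    using A unfolding finite_half_space_intersection_def by blast
  have FW: "H \<subseteq> carrier W" if "H \<in> F" for H
    using that F(2) unfolding half_spaces_eq by auto
  have "y \<in> s <# A \<longleftrightarrow> y \<in> carrier W \<inter> \<Inter>((\<lambda>H. s <# H) ` F)" for y
    using s FW F(3) by (auto simp: mem_l_coset_iff)
  then have "s <# A = carrier W \<inter> \<Inter>((\<lambda>H. s <# H) ` F)" by blast
  moreover have "(\<lambda>H. s <# H) ` F \<subseteq> half_spaces W S"
    using half_space_l_coset[OF s] F(2) by blast
  ultimately show ?thesis
    unfolding finite_half_space_intersection_def using F(1) by blast
qed

end

section \<open>The simple refinement\<close>

theorem theorem4p22:
  fixes W :: "('a, 'b) monoid_scheme" and S :: "'a set"
    and \<P> \<P>' X :: "'a set set" and P P\<^sub>0' :: "'a set"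
    and g :: "'a set \<Rightarrow> 'a" and s :: 'a
  assumes "coxeter_system W S" and "finite S"
    and "locally_constant_partition W S \<P>"
    and "convex_partition W S \<P>"
    and "gated_partition W S \<P>"
    and gates: "\<And>Q. Q \<in> \<P> \<Longrightarrow> is_gate W S (g Q) Q"
    and "is_simple_refinement W S \<P> P s \<P>'"
    and X: "X = {P' \<in> \<P>. (s <#\<^bsub>W\<^esub> P) \<inter> P' \<noteq> {}}"
    and P0: "P\<^sub>0' \<in> X" "s \<otimes>\<^bsub>W\<^esub> g P \<in> P\<^sub>0'"
  shows "(locally_constant_partition W S \<P>' \<and> convex_partition W S \<P>' \<and>
           gated_partition W S \<P>') \<and>
         (is_gate W S (g P) (P \<inter> (s <#\<^bsub>W\<^esub> P\<^sub>0')) \<and>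
           (\<forall>P'\<in>X - {P\<^sub>0'}.
              bounded_subset W S {g P, s \<otimes>\<^bsub>W\<^esub> g P'} \<and>
              is_gate W S (g P \<squnion>\<^bsub>weak_order W S\<^esub> (s \<otimes>\<^bsub>W\<^esub> g P')) (P \<inter> (s <#\<^bsub>W\<^esub> P')))) \<and>
         ((\<forall>Q\<in>\<P>. finite_half_space_intersection W S Q) \<longrightarrow>
           (\<forall>Q\<in>\<P>'. finite_half_space_intersection W S Q))"
proof -
  interpret coxeter_system W S by fact
  have part: "partition_on (carrier W) \<P>"
    and const: "\<And>Q x y. Q \<in> \<P> \<Longrightarrow> x \<in> Q \<Longrightarrow> y \<in> Q \<Longrightarrow> left_descents W S x = left_descents W S y"
    and convex: "\<And>Q. Q \<in> \<P> \<Longrightarrow> convex_subset W S Q"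
    using assms(3,4) unfolding locally_constant_partition_def convex_partition_def by blast+
  have P: "P \<in> \<P>" and s: "s \<in> S" and not_desc: "s \<notin> part_descents W S P"
    and P'_eq: "\<P>' = (\<P> - {P}) \<union> (\<lambda>Q. P \<inter> (s <#\<^bsub>W\<^esub> Q)) ` X"
    using assms(7) unfolding is_simple_refinement_def X by auto
  have \<P>_W: "Q \<subseteq> carrier W" if "Q \<in> \<P>" for Q
    using part that unfolding partition_on_def by blast
  have X_\<P>: "Q \<in> \<P>" if "Q \<in> X" for Q using that X by blast
  have coset: "y \<in> s <#\<^bsub>W\<^esub> Q \<longleftrightarrow> y \<in> carrier W \<and> s \<otimes>\<^bsub>W\<^esub> y \<in> Q" if "Q \<in> \<P>" for Q y
    using mem_l_coset_iff[of s Q y] \<P>_W[OF that] s by simp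
  have X_meets: "\<exists>x\<in>P. s \<otimes>\<^bsub>W\<^esub> x \<in> Q" if "Q \<in> X" for Q
    using that unfolding X l_coset_def by auto
  have P_desc: "s \<notin> left_descents W S x" if "x \<in> P" for x
  proof -
    \<comment> \<open>The value of \<open>the_elem\<close> is determined only for a singleton, which
      the image is because \<open>P\<close> contains \<open>x\<close>.\<close>
    have "left_descents W S ` P = {left_descents W S x}" using const[OF P] that by blast
    then show ?thesis using not_desc by (simp add: part_descents_def)
  qed
  \<comment> \<open>Some \<open>x\<close> in \<open>P\<close> has \<open>s \<otimes> x\<close> in
    \<open>Q\<close>. Since \<open>s\<close> is not a descent of \<open>x\<close>, it is one of
    \<open>s \<otimes> x\<close>, and constancy on \<open>Q\<close> carries this to every
    \<open>y\<close>.\<close>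
  have X_desc: "s \<in> left_descents W S y" if "Q \<in> X" "y \<in> Q" for Q y
    using X_meets[OF that(1)] const[OF X_\<P>[OF that(1)] that(2)] P_desc left_descents_flip \<P>_W[OF P] s
    by (metis subsetD)
  have join: "bounded_subset W S {g P, s \<otimes>\<^bsub>W\<^esub> g Q}"
    "is_gate W S (g P \<squnion>\<^bsub>weak_order W S\<^esub> (s \<otimes>\<^bsub>W\<^esub> g Q)) (P \<inter> (s <#\<^bsub>W\<^esub> Q))"
    and ne: "P \<inter> (s <#\<^bsub>W\<^esub> Q) \<noteq> {}" if Q: "Q \<in> X" for Q
  proof -
    show "P \<inter> (s <#\<^bsub>W\<^esub> Q) \<noteq> {}"
      using X_meets[OF Q] coset[OF X_\<P>[OF Q]] \<P>_W[OF P] by blast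
    moreover have "is_gate W S (s \<otimes>\<^bsub>W\<^esub> g Q) (s <#\<^bsub>W\<^esub> Q)"
      using is_gate_l_coset[OF s gates[OF X_\<P>[OF Q]]] X_desc[OF Q] by blast
    moreover have "convex_subset W S (s <#\<^bsub>W\<^esub> Q)"
      using convex_l_coset convex[OF X_\<P>[OF Q]] s by simp
    ultimately show "bounded_subset W S {g P, s \<otimes>\<^bsub>W\<^esub> g Q}"
      "is_gate W S (g P \<squnion>\<^bsub>weak_order W S\<^esub> (s \<otimes>\<^bsub>W\<^esub> g Q)) (P \<inter> (s <#\<^bsub>W\<^esub> Q))"
      using is_gate_Int[OF convex[OF P] gates[OF P]] by blast+
  qed
  have disj: "A \<inter> B = {}" if "A \<in> \<P>" "B \<in> \<P>" "A \<noteq> B" for A B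
    using part that unfolding partition_on_def disjoint_def by blast
  have part': "partition_on (carrier W) \<P>'"
  proof (rule partition_onI)
    show "\<Union>\<P>' = carrier W"
    proof
      show "\<Union>\<P>' \<subseteq> carrier W" unfolding P'_eq using \<P>_W P by blast
      show "carrier W \<subseteq> \<Union>\<P>'"
      proof
        fix x assume x: "x \<in> carrier W"
        then obtain Q where Q: "Q \<in> \<P>" "x \<in> Q" using part unfolding partition_on_def by blast
        show "x \<in> \<Union>\<P>'"
        proof (cases "Q = P")
          case True
          have "s \<otimes>\<^bsub>W\<^esub> x \<in> carrier W" using s x by simp
          then obtain R where R: "R \<in> \<P>" "s \<otimes>\<^bsub>W\<^esub> x \<in> R"
            using part unfolding partition_on_def by blast
          \<comment> \<open>The part \<open>R\<close> containing \<open>s \<otimes> x\<close>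
            decides which piece of \<open>P\<close> contains \<open>x\<close>. This gives covering
            here and disjointness of the pieces below.\<close>
          then have "R \<in> X" using True Q(2) unfolding X l_coset_def by auto
          then show ?thesis using coset[OF R(1)] R(2) x True Q(2) unfolding P'_eq by blast
        qed (use Q P'_eq in blast)
      qed
    qed
    show "disjnt A B" if "A \<in> \<P>'" "B \<in> \<P>'" "A \<noteq> B" for A B
    proof -
      have XX: "(P \<inter> (s <#\<^bsub>W\<^esub> Q)) \<inter> (P \<inter> (s <#\<^bsub>W\<^esub> R)) = {}" if "Q \<in> X" "R \<in> X" "Q \<noteq> R" for Q R
        using disj[OF X_\<P> X_\<P>] that coset[OF X_\<P>] by blast
      have PX: "Q \<inter> (P \<inter> C) = {}" if "Q \<in> \<P> - {P}" for Q C
        using disj[OF P] that by blast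
      have cases: "C \<in> \<P> - {P} \<or> (\<exists>Q\<in>X. C = P \<inter> (s <#\<^bsub>W\<^esub> Q))" if "C \<in> \<P>'" for C
        using that unfolding P'_eq by blast
      from cases[OF that(1)] cases[OF that(2)] show ?thesis
      proof (elim disjE bexE)
        assume "A \<in> \<P> - {P}" "B \<in> \<P> - {P}"
        then show ?thesis using disj that(3) by (simp add: disjnt_def)
      next
        fix Q assume "A \<in> \<P> - {P}" "B = P \<inter> (s <#\<^bsub>W\<^esub> Q)"
        then show ?thesis using PX by (simp add: disjnt_def)
      next
        fix Q assume "B \<in> \<P> - {P}" "A = P \<inter> (s <#\<^bsub>W\<^esub> Q)"
        then show ?thesis using PX by (metis disjnt_def disjnt_sym)
      next
        fix Q R assume "Q \<in> X" "A = P \<inter> (s <#\<^bsub>W\<^esub> Q)" "R \<in> X" "B = P \<inter> (s <#\<^bsub>W\<^esub> R)"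
        then show ?thesis using XX that(3) by (metis disjnt_def)
      qed
    qed
    show "{} \<notin> \<P>'"
      using ne part unfolding P'_eq partition_on_def by blast
  qed
  have sub: "\<exists>R\<in>\<P>. Q \<subseteq> R" if "Q \<in> \<P>'" for Q
    using that P unfolding P'_eq by blast
  have "locally_constant_partition W S \<P>'"
    unfolding locally_constant_partition_def using part' sub const by (meson subsetD)
  moreover have "convex_partition W S \<P>'"
    unfolding convex_partition_def P'_eq
    using part' convex convex_Int[OF convex[OF P] convex_l_coset] X_\<P> s P'_eq by auto
  \<comment> \<open>\<open>join\<close> applies to every member of \<open>X\<close>, including the
    one containing \<open>s \<otimes> g P\<close>, so all new pieces are gated uniformly.\<close>
  moreover have "gated_partition W S \<P>'"
    unfolding gated_partition_def gated_def using part' gates join(2) P'_eq by auto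
  \<comment> \<open>Here \<open>g P\<close> itself belongs to the piece, and the least element of
    \<open>P\<close> is least in any subset that contains it.\<close>
  moreover have "is_gate W S (g P) (P \<inter> (s <#\<^bsub>W\<^esub> P\<^sub>0'))"
  proof (rule is_gate_subset[OF gates[OF P]])
    show "g P \<in> P \<inter> (s <#\<^bsub>W\<^esub> P\<^sub>0')"
      using gates[OF P] P0(2) coset[OF X_\<P>[OF P0(1)]] by (auto simp: is_gate_iff)
  qed blast
  moreover have "\<forall>Q\<in>\<P>'. finite_half_space_intersection W S Q"
    if "\<forall>Q\<in>\<P>. finite_half_space_intersection W S Q"
    using that P X_\<P> half_space_intersection_Int half_space_intersection_l_coset[OF s]
    unfolding P'_eq by blast
  ultimately show ?thesis using join by blast
qed

end
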